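(* Let $x$ be an image. Suppose that for every patch region $p$ (of size $m$) the majority invariant holds for $x$ and $p$, i.e. for every $e=(e_a)_{a\in\mathbb{A}}\in\mathbb{E}_p(x)$, $$\arg\max_{c}\ \sum_{a\in\mathbb{A}}\mathbf 1[e_a=c]\;=\;D_{MC}(x).$$ Then $x$ is certifiably robust on $D_{MC}$.
   Context: Images and labels. An image (sample) is an array $x$ with $h$ rows and $w$ columns of pixels, each pixel being a vector in $\mathbb{R}^k$ ($h,w,k\ge 1$ fixed). Labels form a finite set $C=\{c_1,\dots,c_n\}$, $n\ge 2$, ordered by index: $c_i>c_j$ iff $i>j$. $\mathbf 1[z]$ is $1$ if $z$ holds and $0$ otherwise. Every $\arg\max$ over labels returns the maximizing label with the smallest index. For a binary matrix $q\in\{0,1\}^{h\times w}$, $q\cdot x$ is the entrywise product (each pixel is multiplied by the corresponding entry of $q$); $\cdot$ is also the entrywise product of binary matrices. $J$ is the all-ones matrix and $O$ the zero matrix of size $h\times w$. Patches. Fix an integer $1\le m\le\min(h,w)$. A patch region (of size $m$) is a matrix $p\in\{0,1\}^{h\times w}$ whose entries equal to $1$ form exactly an $m\times m$ square of consecutive rows and consecutive columns. Images $x_1,x_2$ differ by $p$ if $x_1\ne x_2$ and $(J-p)\cdot x_1=(J-p)\cdot x_2$. For a function $D$ from images to labels, an image $x_1$ is certifiably robust on $D$ if $D(x_2)=D(x_1)$ for every patch region $p$ of size $m$ and every image $x_2$ such that $x_1$ and $x_2$ differ by $p$. Ablations. $\mathbb{A}$ is a nonempty finite set of ablation strategies. Each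 $a\in\mathbb{A}$ has a family $\Psi_a$ of ablation regions $\psi\in\{0,1\}^{h\times w}$ of one of three types (rows and columns are indexed from $0$, rows modulo $h$, columns modulo $w$): row type with size $1\le s\le h$: for each $0\le i<h$, the region consisting of the full rows $i,\dots,i+s-1 \bmod h$; column type with size $1\le s\le w$: for each $0\le j<w$, the full columns $j,\dots,j+s-1\bmod w$; block type with size $1\le s\le\min(h,w)$: for each $0\le i<h$, $0\le j<w$, the block of rows $i,\dots,i+s-1\bmod h$ and columns $j,\dots,j+s-1\bmod w$. $\Psi_a$ is regarded as a family indexed by $i$, by $j$, or by $(i,j)$ respectively, and all sums over $\psi\in\Psi_a$ run over these indices. The ablations of $x$ are the images $\psi\cdot x$, $\psi\in\Psi_a$. For each $a\in\mathbb{A}$, $f^a$ is a (fixed, arbitrary) classifier, i.e. a function from images to $C$, and $f^a_c(b)=\mathbf 1[f^a(b)=c]$. Predictions. $g^a(x)=\arg\max_{c}\sum_{\psi\in\Psi_a}f^a_c(\psi\cdot x)$ and $D_{MC}(x)=\arg\max_c\sum_{a\in\mathbb{A}}\mathbf 1[g^a(x)=c]$. Bounds and local-malicious labels. For an image $x$, $a\in\mathbb{A}$, a patch region $p$ and a label $c$, $$\underline{n_c}(x,a,p)=\sum_{\psi\in\Psi_a,\ \psi\cdot p=O}f^a_c(\psi\cdot x),\qquad \overline{n_c}(x,a,p)=\underline{n_c}(x,a,p)+\sum_{\psi\in\Psi_a}\mathbf 1[\psi\cdot p\neq O].$$ With $c=g^a(x)$, a label $c_l\neq c$ is a local-malicious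 label of $x$ for $g^a$ with respect to $p$ iff $\underline{n_c}(x,a,p)<\overline{n_{c_l}}(x,a,p)+\mathbf 1[c>c_l]$. $\mathrm{LOCAL}(x,a,p)$ is the set of all such labels, and $\mathrm{MAY}(x,a,p)=\mathrm{LOCAL}(x,a,p)\cup\{g^a(x)\}$. Finally $\mathbb{E}_p(x)=\prod_{a\in\mathbb{A}}\mathrm{MAY}(x,a,p)$, the set of all families $e=(e_a)_{a\in\mathbb{A}}$ with $e_a\in\mathrm{MAY}(x,a,p)$. *)

theory Defs
  imports "HOL-Analysis.Finite_Cartesian_Product" "Jordan_Normal_Form.Matrix"
begin

hide_const (open) Finite_Cartesian_Product.mat Finite_Cartesian_Product.vec

text \<open>
  Images are matrices with entries in \<open>real ^ 'k\<close>, lying in \<open>carrier_mat h w\<close>. Binary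
  matrices are real matrices with entries 0 and 1, so that \<open>J - p\<close> is ordinary matrix subtraction.
  Rows and columns are indexed from 0. Labels are a finite linearly ordered type.
\<close>

type_synonym 'k image = "(real ^ 'k) mat"

text \<open>Entrywise product; \<open>'b\<close> is either the pixel type or \<open>real\<close> (product of binary matrices).\<close>

definition mask :: "real mat \<Rightarrow> 'b::real_vector mat \<Rightarrow> 'b mat" (infixl "\<cdot>" 70) where
  "q \<cdot> x = mat (dim_row x) (dim_col x) (\<lambda>ij. q $$ ij *\<^sub>R x $$ ij)"

definition ones_mat :: "nat \<Rightarrow> nat \<Rightarrow> real mat" where
  "ones_mat h w = mat h w (\<lambda>_. 1)"

definition label_argmax :: "('c::{finite,linorder} \<Rightarrow> nat) \<Rightarrow> 'c" where
  "label_argmax v = Min {c. is_arg_max v (\<lambda>_. True) c}"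

text \<open>Unlike ablation regions, patch regions do not wrap around the border.\<close>

definition patch_region :: "nat \<Rightarrow> nat \<Rightarrow> nat \<Rightarrow> real mat \<Rightarrow> bool" where
  "patch_region h w m p \<longleftrightarrow>
     (\<exists>i j. i + m \<le> h \<and> j + m \<le> w \<and>
        p = mat h w (\<lambda>(r, c). of_bool (r \<in> {i..<i+m} \<and> c \<in> {j..<j+m})))"

definition differ_by :: "nat \<Rightarrow> nat \<Rightarrow> real mat \<Rightarrow> 'k::finite image \<Rightarrow> 'k image \<Rightarrow> bool" where
  "differ_by h w p x1 x2 \<longleftrightarrow>
     x1 \<noteq> x2 \<and> (ones_mat h w - p) \<cdot> x1 = (ones_mat h w - p) \<cdot> x2"

definition certifiably_robust ::
    "nat \<Rightarrow> nat \<Rightarrow> nat \<Rightarrow> ('k::finite image \<Rightarrow> 'c) \<Rightarrow> 'k image \<Rightarrow> bool" where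
  "certifiably_robust h w m D x1 \<longleftrightarrow>
     (\<forall>p. \<forall>x2 \<in> carrier_mat h w.
        patch_region h w m p \<longrightarrow> differ_by h w p x1 x2 \<longrightarrow> D x2 = D x1)"

text \<open>The type of an ablation strategy together with its size.\<close>

datatype ablation = Row nat | Column nat | Block nat

fun valid_ablation :: "nat \<Rightarrow> nat \<Rightarrow> ablation \<Rightarrow> bool" where
  "valid_ablation h w (Row s) \<longleftrightarrow> 1 \<le> s \<and> s \<le> h"
| "valid_ablation h w (Column s) \<longleftrightarrow> 1 \<le> s \<and> s \<le> w"
| "valid_ablation h w (Block s) \<longleftrightarrow> 1 \<le> s \<and> s \<le> min h w"

text \<open>
  The ablation regions form a family: sums range over the indices, so coinciding regions (for
  instance all row regions when \<open>s = h\<close>) are counted with multiplicity. Indices are pairs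
  \<open>(i, j)\<close>; the irrelevant coordinate is fixed to 0 for the row and column types.
\<close>

fun abl_index :: "nat \<Rightarrow> nat \<Rightarrow> ablation \<Rightarrow> (nat \<times> nat) set" where
  "abl_index h w (Row s) = {0..<h} \<times> {0}"
| "abl_index h w (Column s) = {0} \<times> {0..<w}"
| "abl_index h w (Block s) = {0..<h} \<times> {0..<w}"

definition cyclic_interval :: "nat \<Rightarrow> nat \<Rightarrow> nat \<Rightarrow> nat set" where
  "cyclic_interval l s i = (\<lambda>t. (i + t) mod l) ` {0..<s}"

fun abl_region :: "nat \<Rightarrow> nat \<Rightarrow> ablation \<Rightarrow> nat \<times> nat \<Rightarrow> real mat" where
  "abl_region h w (Row s) (i, j) =
     mat h w (\<lambda>(r, c). of_bool (r \<in> cyclic_interval h s i))"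
| "abl_region h w (Column s) (i, j) =
     mat h w (\<lambda>(r, c). of_bool (c \<in> cyclic_interval w s j))"
| "abl_region h w (Block s) (i, j) =
     mat h w (\<lambda>(r, c). of_bool (r \<in> cyclic_interval h s i \<and> c \<in> cyclic_interval w s j))"

text \<open>
  Below, \<open>t\<close> and \<open>f\<close> are the ablation type and the classifier of a single strategy, while
  \<open>T\<close> and \<open>F\<close> assign them to all strategies in the finite set \<open>A\<close>.
\<close>

definition strategy_predict ::
    "nat \<Rightarrow> nat \<Rightarrow> ablation \<Rightarrow> ('k::finite image \<Rightarrow> 'c::{finite,linorder}) \<Rightarrow> 'k image \<Rightarrow> 'c" where
  "strategy_predict h w t f x =
     label_argmax (\<lambda>c. \<Sum>\<iota>\<in>abl_index h w t. of_bool (f (abl_region h w t \<iota> \<cdot> x) = c))"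

definition D_MC ::
    "nat \<Rightarrow> nat \<Rightarrow> 'a set \<Rightarrow> ('a \<Rightarrow> ablation) \<Rightarrow>
     ('a \<Rightarrow> 'k::finite image \<Rightarrow> 'c::{finite,linorder}) \<Rightarrow> 'k image \<Rightarrow> 'c" where
  "D_MC h w A T F x =
     label_argmax (\<lambda>c. \<Sum>a\<in>A. of_bool (strategy_predict h w (T a) (F a) x = c))"

definition n_lower ::
    "nat \<Rightarrow> nat \<Rightarrow> ablation \<Rightarrow> ('k::finite image \<Rightarrow> 'c) \<Rightarrow> 'k image \<Rightarrow> real mat \<Rightarrow> 'c \<Rightarrow> nat" where
  "n_lower h w t f x p c =
     (\<Sum>\<iota> | \<iota> \<in> abl_index h w t \<and> abl_region h w t \<iota> \<cdot> p = 0\<^sub>m h w.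
        of_bool (f (abl_region h w t \<iota> \<cdot> x) = c))"

definition n_upper ::
    "nat \<Rightarrow> nat \<Rightarrow> ablation \<Rightarrow> ('k::finite image \<Rightarrow> 'c) \<Rightarrow> 'k image \<Rightarrow> real mat \<Rightarrow> 'c \<Rightarrow> nat" where
  "n_upper h w t f x p c =
     n_lower h w t f x p c +
     (\<Sum>\<iota>\<in>abl_index h w t. of_bool (abl_region h w t \<iota> \<cdot> p \<noteq> 0\<^sub>m h w))"

definition LOCAL ::
    "nat \<Rightarrow> nat \<Rightarrow> ablation \<Rightarrow> ('k::finite image \<Rightarrow> 'c::{finite,linorder}) \<Rightarrow>
     'k image \<Rightarrow> real mat \<Rightarrow> 'c set" where
  "LOCAL h w t f x p =
     (let c = strategy_predict h w t f x in
      {c'. c' \<noteq> c \<and> n_lower h w t f x p c < n_upper h w t f x p c' + of_bool (c > c')})"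

definition MAY ::
    "nat \<Rightarrow> nat \<Rightarrow> ablation \<Rightarrow> ('k::finite image \<Rightarrow> 'c::{finite,linorder}) \<Rightarrow>
     'k image \<Rightarrow> real mat \<Rightarrow> 'c set" where
  "MAY h w t f x p = LOCAL h w t f x p \<union> {strategy_predict h w t f x}"

definition EE ::
    "nat \<Rightarrow> nat \<Rightarrow> 'a set \<Rightarrow> ('a \<Rightarrow> ablation) \<Rightarrow>
     ('a \<Rightarrow> 'k::finite image \<Rightarrow> 'c::{finite,linorder}) \<Rightarrow> 'k image \<Rightarrow> real mat \<Rightarrow> ('a \<Rightarrow> 'c) set" where
  "EE h w A T F x p = (\<Pi>\<^sub>E a\<in>A. MAY h w (T a) (F a) x p)"

definition majority_invariant ::
    "nat \<Rightarrow> nat \<Rightarrow> 'a set \<Rightarrow> ('a \<Rightarrow> ablation) \<Rightarrow>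
     ('a \<Rightarrow> 'k::finite image \<Rightarrow> 'c::{finite,linorder}) \<Rightarrow> 'k image \<Rightarrow> real mat \<Rightarrow> bool" where
  "majority_invariant h w A T F x p \<longleftrightarrow>
     (\<forall>e \<in> EE h w A T F x p.
        label_argmax (\<lambda>c. \<Sum>a\<in>A. of_bool (e a = c)) = D_MC h w A T F x)"

end

theory Submission
  imports Defs
begin

text \<open>
  If \<open>x\<close> and \<open>x'\<close> differ only inside the patch \<open>p\<close>, every ablation region disjoint from \<open>p\<close>
  yields the same ablated image for both, so the two images share the bounds \<open>n_lower\<close> and
  \<open>n_upper\<close> for \<open>p\<close>. These bounds enclose the true vote counts at \<open>x'\<close>, hence the label
  predicted by each strategy at \<open>x'\<close> lies in \<open>MAY\<close> of \<open>x\<close>. The predictions at \<open>x'\<close> therefore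
  form a family in \<open>EE\<close>, to which the majority invariant applies.
\<close>

text \<open>Labels form a finite type, so \<open>v\<close> attains its maximum and the
  \<open>Min\<close> in \<open>label_argmax\<close> ranges over a nonempty set.\<close>

lemma is_arg_max_label_argmax:
  fixes v :: "'c::{finite,linorder} \<Rightarrow> nat"
  shows "is_arg_max v (\<lambda>_. True) (label_argmax v)"
proof -
  have "Max (range v) \<in> range v"
    by (rule Max_in) auto
  then obtain c where "v c = Max (range v)"
    by (metis imageE)
  then have "is_arg_max v (\<lambda>_. True) c"
    by (simp add: is_arg_max_linorder)
  then have "label_argmax v \<in> {c. is_arg_max v (\<lambda>_. True) c}"
    unfolding label_argmax_def by (intro Min_in) auto
  then show ?thesis by simp
qed

lemma le_label_argmax: "v c \<le> v (label_argmax v)"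
  using is_arg_max_label_argmax[of v] by (simp add: is_arg_max_linorder)

text \<open>A smaller label with an equal score would be a maximizer below the least one. This
  strictness accounts for the tie-breaking term in \<open>LOCAL\<close>.\<close>

lemma less_label_argmax:
  assumes "c < label_argmax v"
  shows "v c < v (label_argmax v)"
proof (rule ccontr)
  assume "\<not> v c < v (label_argmax v)"
  then have "is_arg_max v (\<lambda>_. True) c"
    using is_arg_max_label_argmax[of v] unfolding is_arg_max_linorder not_less
    by (blast intro: order_trans)
  then have "label_argmax v \<le> c"
    unfolding label_argmax_def by (intro Min_le) auto
  with assms show False by simp
qed

lemma finite_abl_index: "finite (abl_index h w t)"
  by (cases t) auto

lemma patch_region_carrier: "patch_region h w m p \<Longrightarrow> p \<in> carrier_mat h w"
  by (auto simp: patch_region_def)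

text \<open>Pixelwise: where \<open>q\<close> vanishes both products are zero; elsewhere
  disjointness makes \<open>p\<close> vanish, so the factor \<open>1 - p\<close> equals 1 and the
  two pixels agree.\<close>

lemma mask_eq_if_disjoint:
  fixes x x' :: "'b::real_vector mat"
  assumes "p \<in> carrier_mat h w" "x \<in> carrier_mat h w" "x' \<in> carrier_mat h w"
    and eq: "(ones_mat h w - p) \<cdot> x = (ones_mat h w - p) \<cdot> x'"
    and disj: "q \<cdot> p = 0\<^sub>m h w"
  shows "q \<cdot> x = q \<cdot> x'"
proof (rule eq_matI)
  fix i j
  assume "i < dim_row (q \<cdot> x')" "j < dim_col (q \<cdot> x')"
  then have ij: "i < h" "j < w"
    using assms(3) by (auto simp: mask_def)
  have "((ones_mat h w - p) \<cdot> x) $$ (i, j) = ((ones_mat h w - p) \<cdot> x') $$ (i, j)"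
    by (simp only: eq)
  then have "(1 - p $$ (i, j)) *\<^sub>R x $$ (i, j) = (1 - p $$ (i, j)) *\<^sub>R x' $$ (i, j)"
    using ij assms(1-3) by (simp add: mask_def ones_mat_def)
  moreover have "(q \<cdot> p) $$ (i, j) = 0"
    using ij by (simp add: disj)
  then have "q $$ (i, j) = 0 \<or> p $$ (i, j) = 0"
    using ij assms(1) by (simp add: mask_def)
  ultimately have "q $$ (i, j) *\<^sub>R x $$ (i, j) = q $$ (i, j) *\<^sub>R x' $$ (i, j)"
    by auto
  then show "(q \<cdot> x) $$ (i, j) = (q \<cdot> x') $$ (i, j)"
    using ij assms(2,3) by (simp add: mask_def)
qed (use assms(2,3) in \<open>auto simp: mask_def\<close>)

lemma n_lower_cong:
  assumes "p \<in> carrier_mat h w" "x \<in> carrier_mat h w" "x' \<in> carrier_mat h w"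
    and "(ones_mat h w - p) \<cdot> x = (ones_mat h w - p) \<cdot> x'"
  shows "n_lower h w t f x p c = n_lower h w t f x' p c"
  unfolding n_lower_def
  by (intro sum.cong) (auto dest: mask_eq_if_disjoint[OF assms])

lemma n_lower_le_votes:
  "n_lower h w t f x p c \<le> (\<Sum>\<iota>\<in>abl_index h w t. of_bool (f (abl_region h w t \<iota> \<cdot> x) = c))"
  unfolding n_lower_def by (intro sum_mono2) (auto simp: finite_abl_index)

lemma votes_le_n_upper:
  "(\<Sum>\<iota>\<in>abl_index h w t. of_bool (f (abl_region h w t \<iota> \<cdot> x) = c)) \<le> n_upper h w t f x p c"
proof -
  let ?v = "\<lambda>\<iota>. of_bool (f (abl_region h w t \<iota> \<cdot> x) = c) :: nat"
  let ?d = "\<lambda>\<iota>. abl_region h w t \<iota> \<cdot> p = 0\<^sub>m h w"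
  have "n_lower h w t f x p c = (\<Sum>\<iota>\<in>abl_index h w t. if ?d \<iota> then ?v \<iota> else 0)"
    unfolding n_lower_def using sum.inter_filter[OF finite_abl_index] .
  \<comment> \<open>Under a single sum the bound is termwise: a region disjoint from
    \<open>p\<close> contributes its actual vote, any other region contributes 1.\<close>
  then have "n_upper h w t f x p c =
      (\<Sum>\<iota>\<in>abl_index h w t. (if ?d \<iota> then ?v \<iota> else 0) + of_bool (\<not> ?d \<iota>))"
    by (simp add: n_upper_def sum.distrib)
  then show ?thesis
    by (auto intro!: sum_mono)
qed

lemma strategy_predict_mem_MAY:
  assumes "p \<in> carrier_mat h w" "x \<in> carrier_mat h w" "x' \<in> carrier_mat h w"
    and "(ones_mat h w - p) \<cdot> x = (ones_mat h w - p) \<cdot> x'"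
  shows "strategy_predict h w t f x' \<in> MAY h w t f x p"
proof -
  define v where
    "v = (\<lambda>c. \<Sum>\<iota>\<in>abl_index h w t. of_bool (f (abl_region h w t \<iota> \<cdot> x') = c) :: nat)"
  define c where "c = strategy_predict h w t f x"
  define c' where "c' = strategy_predict h w t f x'"
  have c': "c' = label_argmax v"
    by (simp add: c'_def v_def strategy_predict_def)
  have "n_lower h w t f x p c < n_upper h w t f x p c' + of_bool (c > c')" if "c' \<noteq> c"
  proof -
    \<comment> \<open>The lower bound at \<open>x\<close> equals the one at \<open>x'\<close>, where
      \<open>v\<close> counts the votes.\<close>
    have "n_lower h w t f x p c \<le> v c"
      using n_lower_le_votes[of h w t f x' p c] by (simp add: n_lower_cong[OF assms] v_def)
    \<comment> \<open>If \<open>c > c'\<close>, the weak inequality suffices because of the added 1;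
      if \<open>c < c'\<close>, the winner \<open>c'\<close> must beat \<open>c\<close>
      strictly.\<close>
    also have "v c < v c' + of_bool (c > c')"
      using le_label_argmax[of v c] less_label_argmax[of c v] that
      by (cases "c > c'") (auto simp: c' not_less)
    also have "v c' \<le> n_upper h w t f x p c'"
      using votes_le_n_upper[of f h w t x' c' p]
      by (simp add: n_upper_def n_lower_cong[OF assms] v_def)
    finally show ?thesis by simp
  qed
  then show ?thesis
    by (auto simp: MAY_def LOCAL_def Let_def simp flip: c_def c'_def)
qed

theorem theorem2:
  fixes h w m :: nat
    and A :: "'a set"
    and T :: "'a \<Rightarrow> ablation"
    and F :: "'a \<Rightarrow> 'k::finite image \<Rightarrow> 'c::{finite,linorder}"
    and x :: "'k image"
  assumes "h \<ge> 1" and "w \<ge> 1"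
    and "1 \<le> m" and "m \<le> min h w"
    and "CARD('c) \<ge> 2"
    and "finite A" and "A \<noteq> {}"
    and "\<And>a. a \<in> A \<Longrightarrow> valid_ablation h w (T a)"
    and "x \<in> carrier_mat h w"
    and "\<And>p. patch_region h w m p \<Longrightarrow> majority_invariant h w A T F x p"
  shows "certifiably_robust h w m (D_MC h w A T F) x"
  unfolding certifiably_robust_def
proof (intro allI ballI impI)
  fix p and x' :: "'k image"
  assume x': "x' \<in> carrier_mat h w" and p: "patch_region h w m p"
    and "differ_by h w p x x'"
  then have eq: "(ones_mat h w - p) \<cdot> x = (ones_mat h w - p) \<cdot> x'"
    by (simp add: differ_by_def)
  \<comment> \<open>\<open>EE\<close> is an extensional product, hence the restriction to
    \<open>A\<close>; the vote sums over \<open>A\<close> do not see it.\<close>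
  let ?e = "restrict (\<lambda>a. strategy_predict h w (T a) (F a) x') A"
  have "?e \<in> EE h w A T F x p"
    using strategy_predict_mem_MAY[OF patch_region_carrier[OF p] \<open>x \<in> carrier_mat h w\<close> x' eq]
    by (auto simp: EE_def)
  then have "label_argmax (\<lambda>c. \<Sum>a\<in>A. of_bool (?e a = c)) = D_MC h w A T F x"
    using assms(10)[OF p] by (simp only: majority_invariant_def)
  then show "D_MC h w A T F x' = D_MC h w A T F x"
    by (simp add: D_MC_def)
qed

end
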